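(* Let $d\ge 1$, let $f:\mathbb{R}^d\to\mathbb{R}$ be a $\mathcal{C}^1$ function, and suppose that $m>0$, $\sigma>0$ and $r>0$ satisfy $$r\le \frac{2\sigma}{3},\qquad m\ge 2r\sigma-r^2 .$$ If $\nabla f$ belongs to the sector $[m,\infty]$ and $f$ is $m$-quasi-strongly convex, then the system $$\dot q = p,\qquad \dot p=-2\sigma p-\nabla f(q)$$ on $\mathbb{R}^{2d}\ni z=(q,p)$ is $r$-exponentially stable.
   Context: Sector: for $m<L\le\infty$, a continuous function $\phi:\mathbb{R}^n\to\mathbb{R}^n$ belongs to the sector $[m,L]$ if $\langle mw-\phi(w),\,w-L^{-1}\phi(w)\rangle\le 0$ for all $w\in\mathbb{R}^n$, where $L^{-1}=0$ if $L=\infty$ (so for $L=\infty$ the condition is $\langle mw-\phi(w),w\rangle\le 0$). Quasi-strong convexity: a $\mathcal{C}^1$ function $f:\mathbb{R}^n\to\mathbb{R}$ is $m$-quasi-strongly convex (with respect to the origin) if $\nabla f$ belongs to the sector $[m,\infty]$ and $f(w)-\langle\nabla f(w),w\rangle+\frac m2|w|^2\le f(0)$ for all $w\in\mathbb{R}^n$. Exponential stability: an autonomous system $\dot z=F(z)$ with $F$ continuous is $r$-exponentially stable ($r\ge0$) if $z=0$ is an equilibrium point and there is an increasing continuous function $\kappa:[0,\infty)\to[0,\infty)$ with $\kappa(0)=0$ such that $|z(t)|\le\kappa(|z(0)|)\,e^{-rt}$ for each solution $z$ and every $t\ge0$ for which $z$ exists. *)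

theory Defs
  imports "HOL-Analysis.Analysis"
begin

definition grad :: "('a::euclidean_space \<Rightarrow> real) \<Rightarrow> 'a \<Rightarrow> 'a" where
  "grad f x = (THE D. GDERIV f x :> D)"

definition C1_function :: "('a::euclidean_space \<Rightarrow> real) \<Rightarrow> bool" where
  "C1_function f \<longleftrightarrow> (\<forall>x. f differentiable (at x)) \<and> continuous_on UNIV (grad f)"

text \<open>The upper sector bound ranges over the extended reals; the inverse of \<open>\<infinity>\<close> is \<open>0\<close>.\<close>

definition in_sector :: "real \<Rightarrow> ereal \<Rightarrow> ('a::euclidean_space \<Rightarrow> 'a) \<Rightarrow> bool" where
  "in_sector m L \<phi> \<longleftrightarrow>
     ereal m < L \<and> continuous_on UNIV \<phi> \<and>
     (\<forall>w. (m *\<^sub>R w - \<phi> w) \<bullet> (w - real_of_ereal (inverse L) *\<^sub>R \<phi> w) \<le> 0)"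

definition quasi_strongly_convex :: "real \<Rightarrow> ('a::euclidean_space \<Rightarrow> real) \<Rightarrow> bool" where
  "quasi_strongly_convex m f \<longleftrightarrow>
     C1_function f \<and> in_sector m \<infinity> (grad f) \<and>
     (\<forall>w. f w - grad f w \<bullet> w + m / 2 * (norm w)\<^sup>2 \<le> f 0)"

text \<open>A solution lives on an arbitrary interval containing the initial time \<open>0\<close> and need not
  extend to all times; at end points of the interval the derivative is one-sided.\<close>

definition is_solution ::
  "('a::euclidean_space \<Rightarrow> 'a) \<Rightarrow> real set \<Rightarrow> (real \<Rightarrow> 'a) \<Rightarrow> bool" where
  "is_solution F J z \<longleftrightarrow>
     is_interval J \<and> 0 \<in> J \<and>
     (\<forall>t\<in>J. (z has_vector_derivative F (z t)) (at t within J))"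

definition exponentially_stable :: "real \<Rightarrow> ('a::euclidean_space \<Rightarrow> 'a) \<Rightarrow> bool" where
  "exponentially_stable r F \<longleftrightarrow>
     0 \<le> r \<and> continuous_on UNIV F \<and> F 0 = 0 \<and>
     (\<exists>\<kappa> :: real \<Rightarrow> real.
        \<kappa> ` {0..} \<subseteq> {0..} \<and> strict_mono_on {0..} \<kappa> \<and> continuous_on {0..} \<kappa> \<and> \<kappa> 0 = 0 \<and>
        (\<forall>J z. is_solution F J z \<longrightarrow>
           (\<forall>t\<in>J. 0 \<le> t \<longrightarrow> norm (z t) \<le> \<kappa> (norm (z 0)) * exp (- r * t))))"

end

theory Submission
  imports Defs
begin

text \<open>
  The proof uses the Lyapunov function
  \<open>V (q, p) = |p + 2 r q|\<^sup>2 / 2 - r\<^sup>2 |q|\<^sup>2 + f q - f 0\<close>. Quasi-strong convexity yields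
  \<open>V' + 2 r V \<le> - (2 \<sigma> - 3 r) |p + r q|\<^sup>2 \<le> 0\<close> along solutions, and the sector condition
  yields \<open>f q - f 0 \<ge> m |q|\<^sup>2 / 2 \<ge> r\<^sup>2 |q|\<^sup>2\<close>, hence \<open>V \<ge> |p + 2 r q|\<^sup>2 / 2\<close>. In the extremal case
  \<open>r = 2 \<sigma> / 3\<close>, \<open>m = 2 r\<^sup>2\<close> the function \<open>V\<close> need not dominate a positive definite quadratic form,
  but \<open>|p + 2 r q| \<le> C exp (- r t)\<close> always holds, and integrating \<open>q' = - 2 r q + (p + 2 r q)\<close>
  gives the decay of \<open>q\<close>, and then that of \<open>p\<close>.
\<close>

section \<open>Gradients and consequences of the sector condition\<close>

lemma GDERIV_grad:
  fixes f :: "'a::euclidean_space \<Rightarrow> real"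
  assumes "f differentiable (at x)"
  shows "GDERIV f x :> grad f x"
proof -
  obtain f' where f': "(f has_derivative f') (at x)"
    using assms by (auto simp: differentiable_def)
  interpret bounded_linear f' using f' by (rule has_derivative_bounded_linear)
  \<comment> \<open>Riesz representation of the linear functional \<open>f'\<close>. Since
    \<open>grad\<close> is a definite description, existence alone is not enough; uniqueness follows
    from that of the Frechet derivative.\<close>
  have "f' = (\<lambda>h. h \<bullet> (\<Sum>b\<in>Basis. f' b *\<^sub>R b))"
  proof
    fix h
    have "f' h = f' (\<Sum>b\<in>Basis. (h \<bullet> b) *\<^sub>R b)"
      by (simp add: euclidean_representation)
    also have "\<dots> = h \<bullet> (\<Sum>b\<in>Basis. f' b *\<^sub>R b)"
      by (simp add: sum scale inner_sum_right mult.commute)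
    finally show "f' h = h \<bullet> (\<Sum>b\<in>Basis. f' b *\<^sub>R b)" .
  qed
  then have "GDERIV f x :> (\<Sum>b\<in>Basis. f' b *\<^sub>R b)"
    using f' unfolding gderiv_def by simp
  moreover have "D = D'" if "GDERIV f x :> D" "GDERIV f x :> D'" for D D'
  proof -
    have "(\<lambda>h. h \<bullet> D) = (\<lambda>h. h \<bullet> D')"
      using that unfolding gderiv_def by (rule has_derivative_unique)
    then show ?thesis by (metis vector_eq_ldot)
  qed
  ultimately show ?thesis
    unfolding grad_def by (metis theI)
qed

lemma C1_has_derivative:
  assumes "C1_function f"
  shows "(f has_derivative (\<lambda>h. h \<bullet> grad f x)) (at x)"
  using assms GDERIV_grad by (auto simp: C1_function_def gderiv_def)

lemma sector_infinity_lower_bound: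
  assumes "in_sector m \<infinity> \<phi>"
  shows "m * (w \<bullet> w) \<le> \<phi> w \<bullet> w"
  using assms by (auto simp: in_sector_def inner_diff_left)

text \<open>At the origin itself the sector inequality is vacuous. Instead it is tested at
  \<open>t *\<^sub>R ?w\<close> with \<open>?w = - \<phi> 0\<close>, divided by
  \<open>t > 0\<close>, and continuity lets \<open>t\<close> tend to 0. The limit says that minus
  the squared norm of \<open>\<phi> 0\<close> is nonnegative.\<close>

lemma sector_infinity_zero:
  fixes \<phi> :: "'a::euclidean_space \<Rightarrow> 'a"
  assumes "in_sector m \<infinity> \<phi>"
  shows "\<phi> 0 = 0"
proof -
  have cont: "continuous_on UNIV \<phi>" using assms by (simp add: in_sector_def)
  let ?w = "- \<phi> 0"
  have "((\<lambda>t. \<phi> (t *\<^sub>R ?w) \<bullet> ?w - m * t * (?w \<bullet> ?w)) \<longlongrightarrow> \<phi> (0 *\<^sub>R ?w) \<bullet> ?w - m * 0 * (?w \<bullet> ?w)) (at_right 0)"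
    by (intro tendsto_intros continuous_on_tendsto_compose[OF cont]) auto
  moreover have "\<phi> (t *\<^sub>R ?w) \<bullet> ?w - m * t * (?w \<bullet> ?w) \<ge> 0" if "t > 0" for t
  proof -
    have "t * (m * t * (?w \<bullet> ?w)) \<le> t * (\<phi> (t *\<^sub>R ?w) \<bullet> ?w)"
      using sector_infinity_lower_bound[OF assms, of "t *\<^sub>R ?w"] by (simp add: algebra_simps)
    then show ?thesis using that by (simp del: inner_minus_left inner_minus_right scaleR_minus_right)
  qed
  then have "eventually (\<lambda>t. \<phi> (t *\<^sub>R ?w) \<bullet> ?w - m * t * (?w \<bullet> ?w) \<ge> 0) (at_right 0)"
    by (auto simp: eventually_at_filter)
  ultimately have "0 \<le> \<phi> (0 *\<^sub>R ?w) \<bullet> ?w - m * 0 * (?w \<bullet> ?w)"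
    by (rule tendsto_lowerbound) simp
  then have "\<phi> 0 \<bullet> \<phi> 0 \<le> 0" by simp
  then show ?thesis by (metis inner_gt_zero_iff not_less)
qed

text \<open>Along the ray through \<open>w\<close>, the derivative of \<open>f\<close> minus the
  quadratic is \<open>1 / t\<close> times the slack of the sector inequality at
  \<open>t *\<^sub>R w\<close>, hence nonnegative. At \<open>t = 0\<close> this division fails and
  \<open>grad f 0 = 0\<close> takes over.\<close>

lemma sector_infinity_quadratic_growth:
  assumes f: "C1_function f" and sec: "in_sector m \<infinity> (grad f)"
  shows "m / 2 * (w \<bullet> w) \<le> f w - f 0"
proof -
  let ?g = "\<lambda>t. f (t *\<^sub>R w) - m / 2 * t\<^sup>2 * (w \<bullet> w)"
  have der: "(?g has_real_derivative (w \<bullet> grad f (t *\<^sub>R w) - m * t * (w \<bullet> w))) (at t)" for t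
  proof -
    have "((\<lambda>t. f (t *\<^sub>R w)) has_derivative (\<lambda>h. (h *\<^sub>R w) \<bullet> grad f (t *\<^sub>R w))) (at t)"
      by (rule has_derivative_compose[OF _ C1_has_derivative[OF f]])
        (auto intro!: derivative_eq_intros)
    then have "((\<lambda>t. f (t *\<^sub>R w)) has_real_derivative (w \<bullet> grad f (t *\<^sub>R w))) (at t)"
      by (simp add: has_field_derivative_def mult_commute_abs)
    then show ?thesis
      by (auto intro!: derivative_eq_intros)
  qed
  have "?g 0 \<le> ?g 1"
  proof (rule DERIV_nonneg_imp_nondecreasing[of 0 1 ?g])
    fix t :: real assume t: "0 \<le> t" "t \<le> 1"
    have "w \<bullet> grad f (t *\<^sub>R w) - m * t * (w \<bullet> w) \<ge> 0"
    proof (cases "t = 0")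
      case True
      then show ?thesis using sector_infinity_zero[OF sec] by simp
    next
      case False
      have "t * (m * t * (w \<bullet> w)) \<le> t * (w \<bullet> grad f (t *\<^sub>R w))"
        using sector_infinity_lower_bound[OF sec, of "t *\<^sub>R w"]
        by (simp add: algebra_simps inner_commute)
      then show ?thesis using t False by simp
    qed
    then show "\<exists>y. (?g has_real_derivative y) (at t) \<and> 0 \<le> y" using der by blast
  qed simp
  then show ?thesis by simp
qed

section \<open>Decay estimates and monotone majorants\<close>

lemma exp_decay:
  fixes v :: "real \<Rightarrow> real"
  assumes t: "0 \<le> t"
    and der: "\<And>s. s \<in> {0..t} \<Longrightarrow> (v has_vector_derivative v' s) (at s within {0..t})"
    and le: "\<And>s. s \<in> {0..t} \<Longrightarrow> v' s \<le> - c * v s"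
  shows "v t \<le> v 0 * exp (- c * t)"
proof -
  \<comment> \<open>Gronwall argument with the integrating factor \<open>exp (c * s)\<close>, which
    makes \<open>?u\<close> nonincreasing.\<close>
  let ?u = "\<lambda>s. exp (c * s) * v s"
  have du: "(?u has_real_derivative exp (c * s) * (v' s + c * v s)) (at s within {0..t})"
    if "s \<in> {0..t}" for s
    using der[OF that] unfolding has_real_derivative_iff_has_vector_derivative[symmetric]
    by (auto intro!: derivative_eq_intros simp: algebra_simps)
  have "?u t \<le> ?u 0"
  \<comment> \<open>With continuity on the closed interval, the sign of the derivative matters only
    at interior points, where the one-sided notion becomes two-sided.\<close>
  proof (rule DERIV_nonpos_imp_decreasing_open[OF t])
    show "continuous_on {0..t} ?u"
      using du by (rule DERIV_continuous_on)
    fix s assume s: "0 < s" "s < t"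
    then have "at s within {0..t} = at s"
      by (intro at_within_interior) auto
    then show "\<exists>y. (?u has_real_derivative y) (at s) \<and> y \<le> 0"
      using du[of s] le[of s] s
      by (auto intro!: exI[of _ "exp (c * s) * (v' s + c * v s)"] mult_nonneg_nonpos)
  qed
  then show ?thesis by (simp add: exp_minus field_simps)
qed

text \<open>The homogeneous part decays at rate \<open>2 * r\<close>, the forcing only at rate
  \<open>r\<close>. The rates differ, so no factor \<open>t\<close> appears and the slower rate
  \<open>r\<close> survives. After multiplication by \<open>exp (2 * r * s)\<close> the derivative
  is at most \<open>C * exp (r * s)\<close> in norm, with antiderivative
  \<open>?\<psi>\<close>.\<close>

lemma damped_exp_decay:
  fixes x :: "real \<Rightarrow> 'a::real_normed_vector"
  assumes r: "0 < r" and t: "0 \<le> t"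
    and der: "\<And>s. s \<in> {0..t} \<Longrightarrow> (x has_vector_derivative x' s) (at s within {0..t})"
    and bound: "\<And>s. s \<in> {0..t} \<Longrightarrow> norm (x' s + (2 * r) *\<^sub>R x s) \<le> C * exp (- r * s)"
  shows "norm (x t) \<le> (norm (x 0) + C / r) * exp (- r * t)"
proof -
  have C: "0 \<le> C"
    using order_trans[OF norm_ge_zero bound[of 0]] t by simp
  let ?y = "\<lambda>s. exp (2 * r * s) *\<^sub>R x s" and ?\<psi> = "\<lambda>s. C / r * exp (r * s)"
  have dy: "(?y has_vector_derivative exp (2 * r * s) *\<^sub>R (x' s + (2 * r) *\<^sub>R x s)) (at s within {0..t})"
    if "s \<in> {0..t}" for s
    using der[OF that]
    by (auto intro!: derivative_eq_intros simp: algebra_simps)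
  have norm_le: "norm (?y t - ?y 0) \<le> ?\<psi> t - ?\<psi> 0"
  proof (cases "t = 0")
    case False
    then have "0 < t" using t by simp
    then show ?thesis
    proof (rule differentiable_bound_general)
      show "continuous_on {0..t} ?y"
        using dy by (rule continuous_on_vector_derivative)
      show "continuous_on {0..t} ?\<psi>" by (intro continuous_intros)
      fix s assume s: "0 < s" "s < t"
      then have at: "at s within {0..t} = at s"
        by (intro at_within_interior) auto
      show "(?y has_vector_derivative exp (2 * r * s) *\<^sub>R (x' s + (2 * r) *\<^sub>R x s)) (at s)"
        using dy[of s] s at by simp
      show "(?\<psi> has_vector_derivative C * exp (r * s)) (at s)"
        using r unfolding has_real_derivative_iff_has_vector_derivative[symmetric]
        by (auto intro!: derivative_eq_intros)
      have "norm (exp (2 * r * s) *\<^sub>R (x' s + (2 * r) *\<^sub>R x s)) \<le> exp (2 * r * s) * (C * exp (- r * s))"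
        using bound[of s] s by simp
      also have "\<dots> = C * exp (r * s)"
        by (simp add: exp_add[symmetric] mult.left_commute)
      finally show "norm (exp (2 * r * s) *\<^sub>R (x' s + (2 * r) *\<^sub>R x s)) \<le> C * exp (r * s)" .
    qed
  qed simp
  have "exp (2 * r * t) * norm (x t) \<le> norm (x 0) + norm (?y t - ?y 0)"
    using norm_triangle_sub[of "?y t" "?y 0"] by simp
  also have "\<dots> \<le> norm (x 0) + C / r * exp (r * t)"
    using norm_le divide_nonneg_pos[OF C r] by simp
  \<comment> \<open>The initial term is deliberately weakened by \<open>exp (r * t) \<ge> 1\<close>,
    so that both terms share one exponential.\<close>
  also have "\<dots> \<le> norm (x 0) * exp (r * t) + C / r * exp (r * t)"
    using r t by (simp add: mult_left_le_one_le mult_le_cancel_left1)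
  finally have "exp (2 * r * t) * norm (x t) \<le> (norm (x 0) + C / r) * exp (r * t)"
    by (simp add: distrib_right)
  then have "exp (- (2 * r * t)) * (exp (2 * r * t) * norm (x t))
      \<le> exp (- (2 * r * t)) * ((norm (x 0) + C / r) * exp (r * t))"
    by (rule mult_left_mono) simp
  also have "exp (- (2 * r * t)) * ((norm (x 0) + C / r) * exp (r * t))
      = (norm (x 0) + C / r) * exp (- r * t)"
    by (simp add: mult.left_commute flip: exp_add)
  finally show ?thesis
    by (simp add: mult.assoc[symmetric] flip: exp_add)
qed

text \<open>Supplies the comparison function: a bound through the initial value of the Lyapunov
  function becomes one through the norm of the initial state.\<close>

lemma continuous_mono_majorant:
  fixes V :: "'a::euclidean_space \<Rightarrow> real"
  assumes cont: "continuous_on UNIV V" and V0: "V 0 = 0"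
  obtains M :: "real \<Rightarrow> real"
  where "continuous_on {0..} M" "mono_on {0..} M" "M 0 = 0" "\<And>z. V z \<le> M (norm z)"
proof -
  \<comment> \<open>The maximum of \<open>V\<close> over the ball of radius \<open>s\<close>,
    written over a fixed unit ball so that two radii can be compared at the same
    \<open>u\<close>.\<close>
  define M where "M s = (SUP u\<in>cball 0 1. V (s *\<^sub>R u))" for s :: real
  have bdd: "bdd_above ((\<lambda>u. V (s *\<^sub>R u)) ` cball 0 1)" for s
    by (intro bounded_imp_bdd_above compact_imp_bounded compact_continuous_image
        continuous_on_compose2[OF cont] continuous_intros) auto
  have upper: "V z \<le> M s" if "norm z \<le> s" for z s
  proof (cases "s = 0")
    case True
    then have "V z = V (s *\<^sub>R 0)" using that by simp
    also have "\<dots> \<le> M s" unfolding M_def by (intro cSUP_upper bdd) simp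
    finally show ?thesis .
  next
    case False
    then have s: "s > 0" using that norm_ge_zero[of z] by linarith
    have "V z = V (s *\<^sub>R (z /\<^sub>R s))" using s by simp
    also have "\<dots> \<le> M s" unfolding M_def
      using s that by (intro cSUP_upper bdd) (simp add: field_simps)
    finally show ?thesis .
  qed
  have least: "M s \<le> b" if "\<And>u. norm u \<le> 1 \<Longrightarrow> V (s *\<^sub>R u) \<le> b" for s b
    unfolding M_def using that by (intro cSUP_least) auto
  have "continuous_on {0..} M"
    unfolding continuous_on_iff
  proof (intro ballI allI impI)
    fix s e :: real assume s: "s \<in> {0..}" and e: "e > 0"
    \<comment> \<open>The margin 1 in the radius is why the final distance is
      \<open>min d 1\<close>. Passing to the supremum turns strict into weak inequalities, hence
      \<open>e / 2\<close>.\<close>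
    have "uniformly_continuous_on (cball 0 (s + 1)) V"
      by (intro compact_uniformly_continuous continuous_on_subset[OF cont]) auto
    then obtain d where d: "d > 0"
      "\<And>x y. norm x \<le> s + 1 \<Longrightarrow> norm y \<le> s + 1 \<Longrightarrow> dist y x < d \<Longrightarrow> dist (V y) (V x) < e / 2"
      unfolding uniformly_continuous_on_def using e by (metis half_gt_zero mem_cball_0)
    have le: "M a \<le> M b + e / 2"
      if "0 \<le> a" "0 \<le> b" "a \<le> s + 1" "b \<le> s + 1" "\<bar>a - b\<bar> < d" for a b
    proof (rule least)
      fix u :: 'a assume u: "norm u \<le> 1"
      have n: "norm (c *\<^sub>R u) \<le> c" if "0 \<le> c" for c
        using mult_left_le[OF u that] that by simp
      have "dist (a *\<^sub>R u) (b *\<^sub>R u) = \<bar>a - b\<bar> * norm u"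
        by (simp add: dist_norm flip: scaleR_left_diff_distrib)
      also have "\<dots> \<le> \<bar>a - b\<bar>" using u by (simp add: mult_left_le)
      finally have "dist (V (a *\<^sub>R u)) (V (b *\<^sub>R u)) < e / 2"
        using that n[of a] n[of b] by (intro d(2)) auto
      moreover have "V (b *\<^sub>R u) \<le> M b" using n that by (intro upper) auto
      ultimately show "V (a *\<^sub>R u) \<le> M b + e / 2" unfolding dist_real_def by linarith
    qed
    show "\<exists>d>0. \<forall>x'\<in>{0..}. dist x' s < d \<longrightarrow> dist (M x') (M s) < e"
    proof (intro exI[of _ "min d 1"] conjI ballI impI)
      fix x' assume "x' \<in> {0..}" "dist x' s < min d 1"
      then have "M x' \<le> M s + e / 2" "M s \<le> M x' + e / 2"
        using s by (auto intro!: le simp: dist_real_def)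
      then show "dist (M x') (M s) < e" using e by (simp add: dist_real_def)
    qed (use d in auto)
  qed
  moreover have "mono_on {0..} M"
  proof (rule mono_onI)
    fix a b :: real assume ab: "a \<in> {0..}" "b \<in> {0..}" "a \<le> b"
    show "M a \<le> M b"
    proof (rule least)
      fix u :: 'a assume "norm u \<le> 1"
      then have "norm (a *\<^sub>R u) \<le> a" using ab by (simp add: mult_left_le)
      then show "V (a *\<^sub>R u) \<le> M b" using ab by (intro upper) auto
    qed
  qed
  moreover have "M 0 = 0" by (simp add: M_def V0)
  ultimately show ?thesis using that upper by blast
qed

section \<open>The Lyapunov function and its dissipation\<close>

definition lyapunov :: "('a::euclidean_space \<Rightarrow> real) \<Rightarrow> real \<Rightarrow> 'a \<Rightarrow> 'a \<Rightarrow> real" where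
  "lyapunov f r q p =
     (p + (2 * r) *\<^sub>R q) \<bullet> (p + (2 * r) *\<^sub>R q) / 2 - r\<^sup>2 * (q \<bullet> q) + f q - f 0"

lemma lyapunov_lower_bound:
  assumes "C1_function f" "in_sector m \<infinity> (grad f)" "2 * r\<^sup>2 \<le> m"
  shows "(norm (p + (2 * r) *\<^sub>R q))\<^sup>2 \<le> 2 * lyapunov f r q p"
proof -
  have "r\<^sup>2 * (q \<bullet> q) \<le> m / 2 * (q \<bullet> q)"
    using assms(3) by (intro mult_right_mono) auto
  also have "\<dots> \<le> f q - f 0"
    using assms by (intro sector_infinity_quadratic_growth)
  finally show ?thesis
    by (simp add: lyapunov_def power2_norm_eq_inner)
qed

lemma lyapunov_has_vector_derivative:
  assumes f: "C1_function f"
    and q: "(q has_vector_derivative p t) (at t within S)"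
    and p: "(p has_vector_derivative p') (at t within S)"
  shows "((\<lambda>t. lyapunov f r (q t) (p t)) has_vector_derivative
      (p t + (2 * r) *\<^sub>R q t) \<bullet> (p' + (2 * r) *\<^sub>R p t) - 2 * r\<^sup>2 * (q t \<bullet> p t) + p t \<bullet> grad f (q t))
      (at t within S)"
proof -
  have "((\<lambda>t. f (q t)) has_derivative (\<lambda>h. (h *\<^sub>R p t) \<bullet> grad f (q t))) (at t within S)"
    by (rule has_derivative_compose[OF q[unfolded has_vector_derivative_def] C1_has_derivative[OF f]])
  then show ?thesis
    using p q unfolding lyapunov_def has_vector_derivative_def
    by (auto intro!: derivative_eq_intros simp: algebra_simps inner_commute)
qed

text \<open>Right side minus left side is a sum of three nonnegative terms: \<open>?c\<close> times
  the squared norm of \<open>p + r *\<^sub>R q\<close>, \<open>r * ?k\<close> times that of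
  \<open>q\<close>, and \<open>2 * r\<close> times the slack in quasi-strong convexity at
  \<open>q\<close>. The conditions on \<open>r\<close> and \<open>m\<close> say exactly that
  \<open>?c\<close> and \<open>?k\<close> are nonnegative.\<close>

lemma lyapunov_dissipation:
  fixes q p :: "'a::euclidean_space"
  assumes r: "0 < r" "r \<le> 2 * \<sigma> / 3" and m: "2 * r * \<sigma> - r\<^sup>2 \<le> m"
    and qsc: "quasi_strongly_convex m f"
  shows "(p + (2 * r) *\<^sub>R q) \<bullet> ((- (2 * \<sigma>) *\<^sub>R p - grad f q) + (2 * r) *\<^sub>R p)
      - 2 * r\<^sup>2 * (q \<bullet> p) + p \<bullet> grad f q \<le> - (2 * r) * lyapunov f r q p"
proof -
  let ?c = "2 * \<sigma> - 3 * r" and ?k = "m - (2 * r * \<sigma> - r\<^sup>2)"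
  have "0 \<le> ?c * ((p + r *\<^sub>R q) \<bullet> (p + r *\<^sub>R q)) + r * (?k * (q \<bullet> q))"
    using r m by (intro add_nonneg_nonneg mult_nonneg_nonneg) auto
  moreover have "2 * r * (f q - grad f q \<bullet> q + m / 2 * (q \<bullet> q)) \<le> 2 * r * f 0"
    using qsc r by (intro mult_left_mono)
      (auto simp: quasi_strongly_convex_def power2_norm_eq_inner)
  ultimately show ?thesis
    by (simp add: lyapunov_def inner_add_left inner_add_right inner_diff_right
        inner_commute[of q p] inner_commute[of "grad f q"] algebra_simps power2_eq_square
        add_divide_distrib diff_divide_distrib)
qed

section \<open>Exponential stability of the damped system\<close>

theorem theorem1:
  fixes f :: "real ^ 'd \<Rightarrow> real" and m \<sigma> r :: real
  assumes "C1_function f"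
    and "m > 0" and "\<sigma> > 0" and "r > 0"
    and "r \<le> 2 * \<sigma> / 3"
    and "m \<ge> 2 * r * \<sigma> - r\<^sup>2"
    and "in_sector m \<infinity> (grad f)"
    and "quasi_strongly_convex m f"
  shows "exponentially_stable r
    (\<lambda>(q, p). (p, - (2 * \<sigma>) *\<^sub>R p - grad f q) :: (real ^ 'd) \<times> (real ^ 'd))"
proof -
  let ?F = "\<lambda>(q, p). (p, - (2 * \<sigma>) *\<^sub>R p - grad f q) :: (real ^ 'd) \<times> (real ^ 'd)"
  let ?V = "\<lambda>z. lyapunov f r (fst z) (snd z)"
  note f = \<open>C1_function f\<close> and r = \<open>r > 0\<close> and sec = \<open>in_sector m \<infinity> (grad f)\<close>
  \<comment> \<open>Both parameter conditions combine to
    \<open>2 * r\<^sup>2 \<le> 2 * r * \<sigma> - r\<^sup>2 \<le> m\<close>.\<close>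
  have "r * (3 * r) \<le> r * (2 * \<sigma>)"
    using assms by (intro mult_left_mono) auto
  then have mr: "2 * r\<^sup>2 \<le> m"
    using \<open>m \<ge> 2 * r * \<sigma> - r\<^sup>2\<close> by (simp add: power2_eq_square algebra_simps)
  have grad_cont: "continuous_on UNIV (grad f)"
    using f by (simp add: C1_function_def)
  have f_cont: "continuous_on UNIV f"
    using f by (auto simp: C1_function_def intro!: continuous_at_imp_continuous_on
        differentiable_imp_continuous_within)
  have F_cont: "continuous_on UNIV ?F"
    unfolding case_prod_beta
    by (intro continuous_intros continuous_on_compose2[OF grad_cont]) auto
  have F0: "?F 0 = 0"
    using sector_infinity_zero[OF sec] by (simp add: zero_prod_def)
  have "continuous_on UNIV ?V"
    unfolding lyapunov_def
    by (intro continuous_intros continuous_on_compose2[OF f_cont]) auto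
  moreover have "?V 0 = 0" by (simp add: lyapunov_def)
  ultimately obtain M where M: "continuous_on {0..} M" "mono_on {0..} M" "M 0 = 0"
    "\<And>z. ?V z \<le> M (norm z)"
    by (rule continuous_mono_majorant) (rule that)
  \<comment> \<open>With \<open>C = sqrt (2 * M s)\<close>, the final estimate adds
    \<open>(1 + 2 * r) * (s + C / r)\<close> from \<open>q\<close> and \<open>C\<close> from
    \<open>p + (2 * r) *\<^sub>R q\<close>; the coefficient of \<open>C\<close> is
    \<open>(1 + 2 * r) / r + 1 = 3 + 1 / r\<close>. The linear term makes \<open>\<kappa>\<close>
    strictly increasing although \<open>M\<close> is only monotone.\<close>
  define \<kappa> where "\<kappa> s = (1 + 2 * r) * s + (3 + 1 / r) * sqrt (2 * M s)" for s
  have M_nonneg: "0 \<le> M s" if "0 \<le> s" for s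
    using mono_onD[OF M(2), of 0 s] M(3) that by simp
  have "\<kappa> ` {0..} \<subseteq> {0..}"
  proof (rule image_subsetI)
    fix s :: real assume "s \<in> {0..}"
    then show "\<kappa> s \<in> {0..}"
      using r M_nonneg[of s] by (simp add: \<kappa>_def)
  qed
  moreover have "strict_mono_on {0..} \<kappa>"
  proof (rule strict_mono_onI)
    fix a b :: real assume "a \<in> {0..}" "b \<in> {0..}" "a < b"
    then have "M a \<le> M b" by (intro mono_onD[OF M(2)]) auto
    then show "\<kappa> a < \<kappa> b" unfolding \<kappa>_def
      using r \<open>a < b\<close> by (intro add_less_le_mono mult_strict_left_mono mult_left_mono) auto
  qed
  moreover have "continuous_on {0..} \<kappa>"
    unfolding \<kappa>_def by (intro continuous_intros M)
  moreover have "\<kappa> 0 = 0" by (simp add: \<kappa>_def M)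
  moreover have "norm (z t) \<le> \<kappa> (norm (z 0)) * exp (- r * t)"
    if z: "is_solution ?F J z" and t: "t \<in> J" "0 \<le> t" for J z t
  proof -
    define q p where "q s = fst (z s)" and "p s = snd (z s)" for s
    define C where "C = sqrt (2 * M (norm (z 0)))"
    have sub: "{0..t} \<subseteq> J"
      using z t unfolding is_solution_def is_interval_1 by (meson atLeastAtMost_iff subsetI)
    have dz: "(z has_vector_derivative (p s, - (2 * \<sigma>) *\<^sub>R p s - grad f (q s))) (at s within {0..t})"
      if "s \<in> {0..t}" for s
    proof -
      have "(z has_vector_derivative ?F (z s)) (at s within J)"
        using z that sub unfolding is_solution_def by blast
      then show ?thesis
        using sub by (auto simp: q_def p_def case_prod_beta
            intro: has_vector_derivative_within_subset)
    qed
    have dq: "(q has_vector_derivative p s) (at s within {0..t})" if "s \<in> {0..t}" for s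
      using bounded_linear.has_vector_derivative[OF bounded_linear_fst dz[OF that]]
      by (simp add: q_def[abs_def])
    have dp: "(p has_vector_derivative (- (2 * \<sigma>) *\<^sub>R p s - grad f (q s))) (at s within {0..t})"
      if "s \<in> {0..t}" for s
      using bounded_linear.has_vector_derivative[OF bounded_linear_snd dz[OF that]]
      by (simp add: p_def[abs_def])
    have main: "norm (p s + (2 * r) *\<^sub>R q s) \<le> C * exp (- r * s)" if s: "s \<in> {0..t}" for s
    proof -
      have "lyapunov f r (q s) (p s) \<le> lyapunov f r (q 0) (p 0) * exp (- (2 * r) * s)"
      proof (rule exp_decay)
        fix u assume "u \<in> {0..s}"
        then have u: "u \<in> {0..t}" and st: "{0..s} \<subseteq> {0..t}" using s by auto
        show "((\<lambda>t. lyapunov f r (q t) (p t)) has_vector_derivative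
            (p u + (2 * r) *\<^sub>R q u) \<bullet> ((- (2 * \<sigma>) *\<^sub>R p u - grad f (q u)) + (2 * r) *\<^sub>R p u)
              - 2 * r\<^sup>2 * (q u \<bullet> p u) + p u \<bullet> grad f (q u)) (at u within {0..s})"
          using dq[OF u] dp[OF u] st
          by (intro lyapunov_has_vector_derivative f) (auto intro: has_vector_derivative_within_subset)
        show "(p u + (2 * r) *\<^sub>R q u) \<bullet> ((- (2 * \<sigma>) *\<^sub>R p u - grad f (q u)) + (2 * r) *\<^sub>R p u)
              - 2 * r\<^sup>2 * (q u \<bullet> p u) + p u \<bullet> grad f (q u) \<le> - (2 * r) * lyapunov f r (q u) (p u)"
          using assms by (intro lyapunov_dissipation)
      qed (use s in auto)
      also have "\<dots> \<le> M (norm (z 0)) * exp (- (2 * r) * s)"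
        using M(4)[of "z 0"] by (simp add: q_def p_def)
      finally have "(norm (p s + (2 * r) *\<^sub>R q s))\<^sup>2 \<le> 2 * M (norm (z 0)) * exp (- (2 * r) * s)"
        using lyapunov_lower_bound[OF f sec mr, of "p s" "q s"] by simp
      \<comment> \<open>The Lyapunov function decays at rate \<open>2 * r\<close>; the square root
        halves this to \<open>r\<close>.\<close>
      also have "\<dots> = (C * exp (- r * s))\<^sup>2"
        using M_nonneg[of "norm (z 0)"]
        by (simp add: C_def power_mult_distrib exp_double[symmetric] mult.assoc)
      finally show ?thesis
        by (rule power2_le_imp_le) (simp add: C_def M_nonneg)
    qed
    \<comment> \<open>As \<open>q\<close> has derivative \<open>p\<close>, the bound
      \<open>main\<close> is the forcing bound for \<open>q' + 2 r q\<close>.\<close>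
    have q: "norm (q t) \<le> (norm (q 0) + C / r) * exp (- r * t)"
      using r t(2) dq main by (rule damped_exp_decay)
    have "norm (p t) \<le> norm (p t + (2 * r) *\<^sub>R q t) + 2 * r * norm (q t)"
      using norm_triangle_ineq4[of "p t + (2 * r) *\<^sub>R q t" "(2 * r) *\<^sub>R q t"] r by simp
    also have "\<dots> \<le> C * exp (- r * t) + 2 * r * ((norm (q 0) + C / r) * exp (- r * t))"
      using main[of t] q r t by (intro add_mono mult_left_mono) auto
    finally have "norm (q t) + norm (p t) \<le>
        ((1 + 2 * r) * norm (q 0) + (3 + 1 / r) * C) * exp (- r * t)"
      using q r by (simp add: field_simps)
    also have "\<dots> \<le> \<kappa> (norm (z 0)) * exp (- r * t)"
      using r norm_fst_le[of "fst (z 0)" "snd (z 0)"] by (simp add: \<kappa>_def C_def q_def)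
    finally show ?thesis
      using norm_Pair_le[of "q t" "p t"] by (simp add: q_def p_def)
  qed
  ultimately show ?thesis
    unfolding exponentially_stable_def using r F_cont F0 by (intro conjI exI[of _ \<kappa>]) auto
qed

end
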